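(* Let $(V,\mathcal B,\mu)$ be a standard $\sigma$-finite measure space, let $x\mapsto c(x)\in(0,\infty)$ be a measurable function with $c\in L^1_{\mathrm{loc}}(\mu)$, and suppose that $x\mapsto P(x,\cdot)$ is a probability kernel on $(V,\mathcal B)$. Put $d\nu(x)=c(x)\,d\mu(x)$. The following are equivalent: (i) $x\mapsto P(x,\cdot)$ is reversible with respect to $c$, i.e. $\int_B c(x)P(x,A)\,d\mu(x)=\int_A c(x)P(x,B)\,d\mu(x)$ for all $A,B\in\mathcal B$; (ii) $x\mapsto P_n(x,\cdot)$ is reversible with respect to $c$ for any $n\ge1$; (iii) the Markov operator $P$ defined by $x\mapsto P(x,\cdot)$ is self-adjoint on $L^2(\nu)$ and $\nu P=\nu$; (iv) $c(x)P(x,dy)\,d\mu(x)=c(y)P(y,dx)\,d\mu(y)$; (v) the operator $R$ defined by $R(f)(x)=c(x)P(f)(x)$ is symmetric, i.e. $\int_V fR(g)\,d\mu=\int_V R(f)g\,d\mu$ for any bounded real-valued Borel functions $f,g$ on $V$; (vi) the measure $\rho$ on $(V\times V,\mathcal B\times\mathcal B)$ defined by $\rho(A\times B)=\int_V\chi_A R(\chi_B)\,d\mu=\int_V c(x)\chi_A(x) P(\chi_B)(x)\,d\mu(x)$ is symmetric; (vii) for every $n\in\mathbb N$, the measure $\rho_n$ on $(V\times V,\mathcal B\times\mathcal B)$ defined by $\rho_n(A\times B)=\langle\chi_A,P^n(\chi_B)\rangle_{L^2(\nu)}$ is symmetric.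
   Context: $(V,\mathcal B)$ is a standard Borel space and $\mu$ a non-atomic $\sigma$-finite positive measure on it. $c\in L^1_{\mathrm{loc}}(\mu)$ means $\int_A c\,d\mu<\infty$ for every $A\in\mathcal B$ with $\mu(A)<\infty$. A probability kernel assigns to each $x\in V$ a probability measure $P(x,\cdot)$ on $(V,\mathcal B)$, with $x\mapsto P(x,A)$ measurable for all $A\in\mathcal B$. The Markov operator is $P(f)(x)=\int_V f(y)\,P(x,dy)$, and the iterated kernels are $P_1=P$, $P_{n+1}(x,A)=\int_V P_n(y,A)\,P(x,dy)$. The measure $\nu P$ is defined by $(\nu P)(A)=\int_V P(\chi_A)\,d\nu$, $A\in\mathcal B$. A measure $\rho$ on $V\times V$ is symmetric if $\rho(A\times B)=\rho(B\times A)$ for all $A,B\in\mathcal B$. $\chi_A$ is the characteristic function of $A$, and $\langle\cdot,\cdot\rangle_{L^2(\nu)}$ is the inner product of $L^2(\nu)$.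
   Formalization: In (v), symmetry of R is required for nonnegative bounded f,g (values in [0,∞]) and for signed bounded f,g only when |f|R(|g|) is μ-integrable; for all bounded f,g, (v) fails for some reversible P with ν infinite, as the integrals can be undefined or differ. *)

theory Defs
  imports "HOL-Probability.Probability"
begin

definition standard_borel_space :: "'a measure \<Rightarrow> bool" where
  "standard_borel_space M \<longleftrightarrow>
     (\<exists>X. completely_metrizable_space X \<and> separable_space X \<and> topspace X = space M \<and>
          sets M = sigma_sets (space M) {U. openin X U})"

definition nonatomic :: "'a measure \<Rightarrow> bool" where
  "nonatomic M \<longleftrightarrow>
     (\<forall>A\<in>sets M. 0 < emeasure M A \<longrightarrow>
        (\<exists>B\<in>sets M. B \<subseteq> A \<and> 0 < emeasure M B \<and> emeasure M B < emeasure M A))"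

definition locally_integrable :: "'a measure \<Rightarrow> ('a \<Rightarrow> real) \<Rightarrow> bool" where
  "locally_integrable M c \<longleftrightarrow>
     (\<forall>A\<in>sets M. emeasure M A < \<infinity> \<longrightarrow> (\<integral>\<^sup>+x\<in>A. ennreal (c x) \<partial>M) < \<infinity>)"


subsection \<open>Markov operators and kernels\<close>

text \<open>Probability kernels on \<open>M\<close> are the elements of \<open>M \<rightarrow>\<^sub>M prob_algebra M\<close>.\<close>

definition markov_op :: "('a \<Rightarrow> 'a measure) \<Rightarrow> ('a \<Rightarrow> real) \<Rightarrow> 'a \<Rightarrow> real" where
  "markov_op P f x = (\<integral>y. f y \<partial>P x)"

text \<open>The iterated kernels are indexed from 1; the Giry bind is
  \<open>P\<^sub>n\<^sub>+\<^sub>1(x,A) = \<integral> P\<^sub>n(y,A) P(x,dy)\<close>.\<close>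

fun iterated_kernel :: "('a \<Rightarrow> 'a measure) \<Rightarrow> nat \<Rightarrow> 'a \<Rightarrow> 'a measure" where
  "iterated_kernel P (Suc 0) = P"
| "iterated_kernel P (Suc (Suc n)) = (\<lambda>x. P x \<bind> iterated_kernel P (Suc n))"

definition reversible :: "'a measure \<Rightarrow> ('a \<Rightarrow> real) \<Rightarrow> ('a \<Rightarrow> 'a measure) \<Rightarrow> bool" where
  "reversible M c P \<longleftrightarrow>
     (\<forall>A\<in>sets M. \<forall>B\<in>sets M.
        (\<integral>\<^sup>+x\<in>B. ennreal (c x) * emeasure (P x) A \<partial>M) =
        (\<integral>\<^sup>+x\<in>A. ennreal (c x) * emeasure (P x) B \<partial>M))"

text \<open>\<open>(\<nu>P)(A) = \<integral> P(\<chi>\<^sub>A) d\<nu>\<close>\<close>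

definition measure_kernel :: "'a measure \<Rightarrow> ('a \<Rightarrow> 'a measure) \<Rightarrow> 'a measure" where
  "measure_kernel N P =
     measure_of (space N) (sets N) (\<lambda>A. \<integral>\<^sup>+x. ennreal (markov_op P (indicator A) x) \<partial>N)"


subsection \<open>Bounded operators on real \<open>L\<^sup>2\<close>\<close>

definition square_integrable :: "'a measure \<Rightarrow> ('a \<Rightarrow> real) set" where
  "square_integrable N = {f \<in> borel_measurable N. integrable N (\<lambda>x. (f x)\<^sup>2)}"

definition L2_inner :: "'a measure \<Rightarrow> ('a \<Rightarrow> real) \<Rightarrow> ('a \<Rightarrow> real) \<Rightarrow> real" where
  "L2_inner N f g = (\<integral>x. f x * g x \<partial>N)"

text \<open>\<open>T\<close>, given on functions, induces an everywhere defined bounded linear operator on the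
  space of classes of square-integrable functions modulo equality almost everywhere.\<close>

definition bounded_L2_operator :: "'a measure \<Rightarrow> (('a \<Rightarrow> real) \<Rightarrow> 'a \<Rightarrow> real) \<Rightarrow> bool" where
  "bounded_L2_operator N T \<longleftrightarrow>
     (\<forall>f\<in>square_integrable N. T f \<in> square_integrable N) \<and>
     (\<forall>f\<in>square_integrable N. \<forall>g\<in>square_integrable N.
        (AE x in N. f x = g x) \<longrightarrow> (AE x in N. T f x = T g x)) \<and>
     (\<forall>f\<in>square_integrable N. \<forall>g\<in>square_integrable N. \<forall>a b.
        AE x in N. T (\<lambda>y. a * f y + b * g y) x = a * T f x + b * T g x) \<and>
     (\<exists>K. \<forall>f\<in>square_integrable N. L2_inner N (T f) (T f) \<le> K * L2_inner N f f)"

definition self_adjoint_on_L2 :: "'a measure \<Rightarrow> (('a \<Rightarrow> real) \<Rightarrow> 'a \<Rightarrow> real) \<Rightarrow> bool" where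
  "self_adjoint_on_L2 N T \<longleftrightarrow>
     bounded_L2_operator N T \<and>
     (\<forall>f\<in>square_integrable N. \<forall>g\<in>square_integrable N. L2_inner N f (T g) = L2_inner N (T f) g)"

text \<open>The integral in \<open>markov_op\<close> is 0 by convention where it does not converge; the first
  conjunct says that for square-integrable \<open>f\<close> this happens on a null set only.\<close>

definition markov_self_adjoint :: "'a measure \<Rightarrow> ('a \<Rightarrow> 'a measure) \<Rightarrow> bool" where
  "markov_self_adjoint N P \<longleftrightarrow>
     (\<forall>f\<in>square_integrable N. AE x in N. integrable (P x) f) \<and>
     self_adjoint_on_L2 N (markov_op P)"


subsection \<open>The operator \<open>R\<close>\<close>

definition R_op :: "('a \<Rightarrow> real) \<Rightarrow> ('a \<Rightarrow> 'a measure) \<Rightarrow> ('a \<Rightarrow> real) \<Rightarrow> 'a \<Rightarrow> real" where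
  "R_op c P f x = c x * markov_op P f x"

definition bounded_borel :: "'a measure \<Rightarrow> ('a \<Rightarrow> real) set" where
  "bounded_borel M = {f \<in> borel_measurable M. \<exists>K. \<forall>x\<in>space M. \<bar>f x\<bar> \<le> K}"

text \<open>
  \<open>\<integral> f R(g) d\<mu> = \<integral> R(f) g d\<mu>\<close> for bounded Borel functions, whenever the integrals make sense:
  for nonnegative functions as elements of \<open>[0,\<infinity>]\<close>, for signed ones if the double integral
  converges absolutely (the first conjunct, applied to the absolute values, then shows that
  the right-hand side converges absolutely too). As \<open>c\<close> need not be integrable, some such
  proviso is needed: both integrals can exist as iterated integrals and differ, as on a path
  graph with alternating signs.
\<close>

definition symmetric_operator :: "'a measure \<Rightarrow> (('a \<Rightarrow> real) \<Rightarrow> 'a \<Rightarrow> real) \<Rightarrow> bool" where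
  "symmetric_operator M R \<longleftrightarrow>
     (\<forall>f\<in>bounded_borel M. \<forall>g\<in>bounded_borel M.
        (\<forall>x\<in>space M. 0 \<le> f x \<and> 0 \<le> g x) \<longrightarrow>
        (\<integral>\<^sup>+x. ennreal (f x * R g x) \<partial>M) = (\<integral>\<^sup>+x. ennreal (R f x * g x) \<partial>M)) \<and>
     (\<forall>f\<in>bounded_borel M. \<forall>g\<in>bounded_borel M.
        integrable M (\<lambda>x. \<bar>f x\<bar> * R (\<lambda>y. \<bar>g y\<bar>) x) \<longrightarrow>
        (\<integral>x. f x * R g x \<partial>M) = (\<integral>x. R f x * g x \<partial>M))"


subsection \<open>Measures on the product space\<close>

text \<open>The measures \<open>c(x) P(x,dy) d\<mu>(x)\<close> and \<open>c(y) P(y,dx) d\<mu>(y)\<close>, where in both \<open>x\<close> is the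
  first and \<open>y\<close> the second coordinate.\<close>

definition edge_measure :: "'a measure \<Rightarrow> ('a \<Rightarrow> real) \<Rightarrow> ('a \<Rightarrow> 'a measure) \<Rightarrow> ('a \<times> 'a) measure" where
  "edge_measure M c P = measure_of (space M \<times> space M) (sets (M \<Otimes>\<^sub>M M))
     (\<lambda>E. \<integral>\<^sup>+x. ennreal (c x) * (\<integral>\<^sup>+y. indicator E (x, y) \<partial>P x) \<partial>M)"

definition reversed_edge_measure :: "'a measure \<Rightarrow> ('a \<Rightarrow> real) \<Rightarrow> ('a \<Rightarrow> 'a measure) \<Rightarrow> ('a \<times> 'a) measure" where
  "reversed_edge_measure M c P = measure_of (space M \<times> space M) (sets (M \<Otimes>\<^sub>M M))
     (\<lambda>E. \<integral>\<^sup>+y. ennreal (c y) * (\<integral>\<^sup>+x. indicator E (x, y) \<partial>P y) \<partial>M)"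

text \<open>The measure on the product \<open>\<sigma>\<close>-algebra with prescribed values on measurable rectangles.\<close>

definition rectangle_measure :: "'a measure \<Rightarrow> ('a set \<Rightarrow> 'a set \<Rightarrow> ennreal) \<Rightarrow> ('a \<times> 'a) measure" where
  "rectangle_measure M m = extend_measure (space M \<times> space M)
     {(A, B). A \<in> sets M \<and> B \<in> sets M} (\<lambda>(A, B). A \<times> B) (\<lambda>(A, B). m A B)"

definition rho :: "'a measure \<Rightarrow> ('a \<Rightarrow> real) \<Rightarrow> ('a \<Rightarrow> 'a measure) \<Rightarrow> ('a \<times> 'a) measure" where
  "rho M c P = rectangle_measure M
     (\<lambda>A B. \<integral>\<^sup>+x. ennreal (indicator A x * R_op c P (indicator B) x) \<partial>M)"

text \<open>The inner product is taken in \<open>[0,\<infinity>]\<close>, since \<open>\<chi>\<^sub>A\<close> and \<open>\<chi>\<^sub>B\<close> need not be in \<open>L\<^sup>2(\<nu>)\<close>.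
  The case \<open>n = 0\<close> gives \<open>\<nu>(A \<inter> B)\<close>.\<close>

definition rho_n :: "'a measure \<Rightarrow> ('a \<Rightarrow> real) \<Rightarrow> ('a \<Rightarrow> 'a measure) \<Rightarrow> nat \<Rightarrow> ('a \<times> 'a) measure" where
  "rho_n M c P n = rectangle_measure M
     (\<lambda>A B. \<integral>\<^sup>+x. ennreal (indicator A x * (markov_op P ^^ n) (indicator B) x)
              \<partial>density M (\<lambda>x. ennreal (c x)))"

definition symmetric_measure :: "'a measure \<Rightarrow> ('a \<times> 'a) measure \<Rightarrow> bool" where
  "symmetric_measure M \<rho> \<longleftrightarrow>
     (\<forall>A\<in>sets M. \<forall>B\<in>sets M. emeasure \<rho> (A \<times> B) = emeasure \<rho> (B \<times> A))"


subsection \<open>The measures defined above have the prescribed values\<close>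

lemma sets_product_measures [simp]:
  "sets (edge_measure M c P) = sets (M \<Otimes>\<^sub>M M)"
  "sets (reversed_edge_measure M c P) = sets (M \<Otimes>\<^sub>M M)"
  "sets (rectangle_measure M m) = sets (M \<Otimes>\<^sub>M M)"
proof -
  have *: "sets (M \<Otimes>\<^sub>M M) \<subseteq> Pow (space M \<times> space M)"
    by (metis sets.space_closed space_pair_measure)
  show "sets (edge_measure M c P) = sets (M \<Otimes>\<^sub>M M)"
    "sets (reversed_edge_measure M c P) = sets (M \<Otimes>\<^sub>M M)"
    using * sets.sigma_sets_eq[of "M \<Otimes>\<^sub>M M"]
    by (simp_all add: edge_measure_def reversed_edge_measure_def space_pair_measure)
  have "(\<lambda>(A, B). A \<times> B) ` {(A, B). A \<in> sets M \<and> B \<in> sets M}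
      = {a \<times> b | a b. a \<in> sets M \<and> b \<in> sets M}"
    by auto
  moreover have "(\<lambda>(A, B). A \<times> B) ` {(A, B). A \<in> sets M \<and> B \<in> sets M} \<subseteq> Pow (space M \<times> space M)"
    using sets.sets_into_space by fastforce
  ultimately show "sets (rectangle_measure M m) = sets (M \<Otimes>\<^sub>M M)"
    unfolding rectangle_measure_def by (simp add: sets_extend_measure sets_pair_measure)
qed

context
  fixes M :: "'a measure" and c :: "'a \<Rightarrow> real" and P :: "'a \<Rightarrow> 'a measure"
  assumes c[measurable]: "c \<in> borel_measurable M" and P: "P \<in> M \<rightarrow>\<^sub>M prob_algebra M"
begin

lemma kernel_space:
  assumes "x \<in> space M"
  shows "prob_space (P x)" "sets (P x) = sets M" "space (P x) = space M"
  using measurable_space[OF P assms] by (auto simp: space_prob_algebra dest: sets_eq_imp_space_eq)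

lemma edge_countably_additive:
  assumes h[measurable]: "h \<in> M \<Otimes>\<^sub>M M \<rightarrow>\<^sub>M M \<Otimes>\<^sub>M M"
  shows "countably_additive (sets (M \<Otimes>\<^sub>M M))
     (\<lambda>E. \<integral>\<^sup>+x. ennreal (c x) * (\<integral>\<^sup>+y. indicator E (h (x, y)) \<partial>P x) \<partial>M)"
proof (rule countably_additiveI, goal_cases)
  case (1 E)
  note PM = measurable_prob_algebraD[OF P]
  have E[measurable]: "E i \<in> sets (M \<Otimes>\<^sub>M M)" for i using 1 by auto
  have [measurable]: "(\<lambda>x. \<integral>\<^sup>+y. indicator (E i) (h (x, y)) \<partial>P x) \<in> borel_measurable M" for i
    by (rule nn_integral_measurable_subprob_algebra2[OF _ PM]) measurable
  have "(\<Sum>i. \<integral>\<^sup>+x. ennreal (c x) * (\<integral>\<^sup>+y. indicator (E i) (h (x, y)) \<partial>P x) \<partial>M)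
     = (\<integral>\<^sup>+x. (\<Sum>i. ennreal (c x) * (\<integral>\<^sup>+y. indicator (E i) (h (x, y)) \<partial>P x)) \<partial>M)"
    by (rule nn_integral_suminf[symmetric]) measurable
  also have "\<dots> = (\<integral>\<^sup>+x. ennreal (c x) * (\<integral>\<^sup>+y. indicator (\<Union>i. E i) (h (x, y)) \<partial>P x) \<partial>M)"
  proof (rule nn_integral_cong, goal_cases)
    case (1 x)
    note [measurable_cong] = kernel_space(2)[OF 1]
    have "(\<Sum>i. (\<integral>\<^sup>+y. indicator (E i) (h (x, y)) \<partial>P x))
       = (\<integral>\<^sup>+y. (\<Sum>i. indicator (E i) (h (x, y))) \<partial>P x)"
      using 1 by (intro nn_integral_suminf[symmetric]) measurable
    also have "\<dots> = (\<integral>\<^sup>+y. indicator (\<Union>i. E i) (h (x, y)) \<partial>P x)"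
      using \<open>disjoint_family E\<close> by (simp add: suminf_indicator)
    finally show ?case by simp
  qed
  finally show ?case .
qed

lemma emeasure_edge_measure:
  assumes "E \<in> sets (M \<Otimes>\<^sub>M M)"
  shows "emeasure (edge_measure M c P) E
     = (\<integral>\<^sup>+x. ennreal (c x) * (\<integral>\<^sup>+y. indicator E (x, y) \<partial>P x) \<partial>M)"
proof (rule emeasure_measure_of[OF edge_measure_def])
  show "sets (M \<Otimes>\<^sub>M M) \<subseteq> Pow (space M \<times> space M)"
    by (metis sets.space_closed space_pair_measure)
qed (use assms edge_countably_additive[of "\<lambda>z. z"] in \<open>simp_all add: positive_def\<close>)

lemma emeasure_reversed_edge_measure:
  assumes "E \<in> sets (M \<Otimes>\<^sub>M M)"
  shows "emeasure (reversed_edge_measure M c P) E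
     = (\<integral>\<^sup>+y. ennreal (c y) * (\<integral>\<^sup>+x. indicator E (x, y) \<partial>P y) \<partial>M)"
proof (rule emeasure_measure_of[OF reversed_edge_measure_def])
  show "sets (M \<Otimes>\<^sub>M M) \<subseteq> Pow (space M \<times> space M)"
    by (metis sets.space_closed space_pair_measure)
qed (use assms edge_countably_additive[of "\<lambda>z. (snd z, fst z)"] in \<open>simp_all add: positive_def\<close>)

lemma emeasure_edge_measure_Times:
  assumes [measurable]: "A \<in> sets M" "B \<in> sets M"
  shows "emeasure (edge_measure M c P) (A \<times> B)
     = (\<integral>\<^sup>+x. ennreal (c x) * (indicator A x * emeasure (P x) B) \<partial>M)"
proof (subst emeasure_edge_measure, goal_cases)
  case 2
  show ?case
  proof (rule nn_integral_cong, goal_cases)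
    case (1 x)
    note [measurable_cong] = kernel_space(2)[OF 1]
    show ?case
      by (simp add: indicator_times nn_integral_cmult kernel_space(2)[OF 1])
  qed
qed simp

lemma emeasure_measure_kernel:
  assumes N: "sets N = sets M" and "A \<in> sets M"
  shows "emeasure (measure_kernel N P) A = (\<integral>\<^sup>+x. ennreal (markov_op P (indicator A) x) \<partial>N)"
proof (rule emeasure_measure_of[OF measure_kernel_def])
  note [measurable] = measurable_prob_algebraD[OF P]
  note [measurable_cong] = N
  have eq: "(\<integral>\<^sup>+x. ennreal (markov_op P (indicator B) x) \<partial>N) = (\<integral>\<^sup>+x. emeasure (P x) B \<partial>N)"
    if "B \<in> sets M" for B
  proof (rule nn_integral_cong, goal_cases)
    case (1 x)
    then have x: "x \<in> space M" using sets_eq_imp_space_eq[OF N] by simp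
    interpret prob_space "P x" by (rule kernel_space[OF x])
    show ?case
      using kernel_space[OF x] sets.sets_into_space[OF that]
      by (simp add: markov_op_def emeasure_eq_measure Int_absorb2)
  qed
  have sets_MK: "sets (measure_kernel N P) = sets M"
    using N sets.sigma_sets_eq[of N] sets.space_closed[of N] by (simp add: measure_kernel_def)
  show "countably_additive (sets (measure_kernel N P))
     (\<lambda>A. \<integral>\<^sup>+x. ennreal (markov_op P (indicator A) x) \<partial>N)"
  proof (rule countably_additiveI, goal_cases)
    case (1 E)
    then have E[measurable]: "E i \<in> sets M" for i
      using sets_MK by auto
    have "(\<Sum>i. \<integral>\<^sup>+x. emeasure (P x) (E i) \<partial>N) = (\<integral>\<^sup>+x. (\<Sum>i. emeasure (P x) (E i)) \<partial>N)"
      by (rule nn_integral_suminf[symmetric]) measurable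
    also have "\<dots> = (\<integral>\<^sup>+x. emeasure (P x) (\<Union>i. E i) \<partial>N)"
      using 1 kernel_space sets_eq_imp_space_eq[OF N]
      by (intro nn_integral_cong suminf_emeasure) auto
    finally show ?case by (simp add: eq)
  qed
  show "positive (sets (measure_kernel N P)) (\<lambda>A. \<integral>\<^sup>+x. ennreal (markov_op P (indicator A) x) \<partial>N)"
    by (simp add: positive_def markov_op_def)
  show "sets N \<subseteq> Pow (space N)" by (rule sets.space_closed)
  show "A \<in> sets (measure_kernel N P)" using assms sets_MK by simp
qed

lemma iterated_kernel_props:
  "iterated_kernel P (Suc n) \<in> M \<rightarrow>\<^sub>M prob_algebra M"
  by (induction n) (auto intro: measurable_bind_prob_space P)

lemma emeasure_iterated_kernel_Suc:
  assumes "x \<in> space M" "A \<in> sets M"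
  shows "emeasure (iterated_kernel P (Suc (Suc n)) x) A
     = (\<integral>\<^sup>+y. emeasure (iterated_kernel P (Suc n) y) A \<partial>P x)"
  using assms kernel_space[of x] measurable_prob_algebraD[OF iterated_kernel_props[of n]]
  by (auto intro!: emeasure_bind cong: measurable_cong_sets)

lemma markov_op_funpow_indicator:
  "\<exists>K \<in> M \<rightarrow>\<^sub>M prob_algebra M. \<forall>x\<in>space M. \<forall>B\<in>sets M.
     (markov_op P ^^ n) (indicator B) x = measure (K x) B"
proof (induction n)
  case 0
  show ?case
    by (intro bexI[of _ "return M"]) (auto simp: measure_return split: split_indicator)
next
  case (Suc n)
  then obtain K where K: "K \<in> M \<rightarrow>\<^sub>M prob_algebra M"
    and eq: "\<And>x B. x \<in> space M \<Longrightarrow> B \<in> sets M \<Longrightarrow> (markov_op P ^^ n) (indicator B) x = measure (K x) B"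
    by blast
  have "(markov_op P ^^ Suc n) (indicator B) x = measure (P x \<bind> K) B"
    if x: "x \<in> space M" and B: "B \<in> sets M" for x B
  proof -
    interpret prob_space "P x" by (rule kernel_space[OF x])
    have "measure (P x \<bind> K) B = (\<integral>y. measure (K y) B \<partial>P x)"
      using measurable_prob_algebraD[OF K] kernel_space(2)[OF x] B
      by (intro measure_bind[where N = M]) (auto cong: measurable_cong_sets)
    also have "\<dots> = (\<integral>y. (markov_op P ^^ n) (indicator B) y \<partial>P x)"
      using eq B kernel_space(3)[OF x] by (intro Bochner_Integration.integral_cong) auto
    finally show ?thesis by (simp add: markov_op_def)
  qed
  then show ?case
    using measurable_bind_prob_space[OF P K] by (intro bexI[of _ "\<lambda>x. P x \<bind> K"]) auto
qed

end

lemma emeasure_rectangle_measure: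
  assumes c: "c \<in> borel_measurable M" and K: "K \<in> M \<rightarrow>\<^sub>M prob_algebra M"
    and m: "\<And>A B. A \<in> sets M \<Longrightarrow> B \<in> sets M \<Longrightarrow>
       m A B = (\<integral>\<^sup>+x. ennreal (c x) * (indicator A x * emeasure (K x) B) \<partial>M)"
    and "A \<in> sets M" "B \<in> sets M"
  shows "emeasure (rectangle_measure M m) (A \<times> B) = m A B"
proof (rule emeasure_extend_measure_Pair[OF rectangle_measure_def,
      where \<mu>' = "emeasure (edge_measure M c K)"])
  show "positive (sets (rectangle_measure M m)) (emeasure (edge_measure M c K))"
    by (simp add: positive_def)
  show "countably_additive (sets (rectangle_measure M m)) (emeasure (edge_measure M c K))"
    using emeasure_countably_additive[of "edge_measure M c K"] by simp
qed (use assms in \<open>auto simp: emeasure_edge_measure_Times dest: sets.sets_into_space\<close>)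

lemma emeasure_rho_n:
  assumes c[measurable]: "c \<in> borel_measurable M"
    and P: "P \<in> M \<rightarrow>\<^sub>M prob_algebra M" and "A \<in> sets M" "B \<in> sets M"
  shows "emeasure (rho_n M c P n) (A \<times> B) =
     (\<integral>\<^sup>+x. ennreal (indicator A x * (markov_op P ^^ n) (indicator B) x)
         \<partial>density M (\<lambda>x. ennreal (c x)))"
proof -
  obtain K where K: "K \<in> M \<rightarrow>\<^sub>M prob_algebra M"
    and eq: "\<And>x B. x \<in> space M \<Longrightarrow> B \<in> sets M \<Longrightarrow> (markov_op P ^^ n) (indicator B) x = measure (K x) B"
    using markov_op_funpow_indicator[OF c P, of n] by blast
  note [measurable] = measurable_prob_algebraD[OF K]
  show ?thesis
    unfolding rho_n_def
  proof (rule emeasure_rectangle_measure[OF c K _ assms(3,4)])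
    fix A B assume [measurable]: "A \<in> sets M" "B \<in> sets M"
    have "(\<integral>\<^sup>+x. ennreal (indicator A x * (markov_op P ^^ n) (indicator B) x)
           \<partial>density M (\<lambda>x. ennreal (c x)))
        = (\<integral>\<^sup>+x. ennreal (indicator A x * measure (K x) B) \<partial>density M (\<lambda>x. ennreal (c x)))"
      by (intro nn_integral_cong) (simp add: eq)
    also have "\<dots> = (\<integral>\<^sup>+x. ennreal (c x) * ennreal (indicator A x * measure (K x) B) \<partial>M)"
      by (rule nn_integral_density) measurable
    also have "\<dots> = (\<integral>\<^sup>+x. ennreal (c x) * (indicator A x * emeasure (K x) B) \<partial>M)"
    proof (rule nn_integral_cong, goal_cases)
      case (1 x)
      interpret prob_space "K x" by (rule kernel_space[OF c K 1])
      show ?case by (simp add: emeasure_eq_measure split: split_indicator)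
    qed
    finally show "(\<integral>\<^sup>+x. ennreal (indicator A x * (markov_op P ^^ n) (indicator B) x)
           \<partial>density M (\<lambda>x. ennreal (c x)))
       = (\<integral>\<^sup>+x. ennreal (c x) * (indicator A x * emeasure (K x) B) \<partial>M)" .
  qed
qed

lemma emeasure_rho:
  assumes c[measurable]: "c \<in> borel_measurable M" and pos: "\<And>x. x \<in> space M \<Longrightarrow> 0 < c x"
    and P: "P \<in> M \<rightarrow>\<^sub>M prob_algebra M" and "A \<in> sets M" "B \<in> sets M"
  shows "emeasure (rho M c P) (A \<times> B)
     = (\<integral>\<^sup>+x. ennreal (indicator A x * R_op c P (indicator B) x) \<partial>M)"
  unfolding rho_def
proof (rule emeasure_rectangle_measure[OF c P _ assms(4,5)])
  fix A B assume [measurable]: "A \<in> sets M" "B \<in> sets M"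
  show "(\<integral>\<^sup>+x. ennreal (indicator A x * R_op c P (indicator B) x) \<partial>M)
     = (\<integral>\<^sup>+x. ennreal (c x) * (indicator A x * emeasure (P x) B) \<partial>M)"
  proof (rule nn_integral_cong, goal_cases)
    case (1 x)
    interpret prob_space "P x" by (rule kernel_space[OF c P 1])
    have "B \<inter> space (P x) = B"
      using kernel_space(3)[OF c P 1] sets.sets_into_space[OF \<open>B \<in> sets M\<close>] by auto
    then show ?case
      using pos[OF 1]
      by (simp add: R_op_def markov_op_def emeasure_eq_measure ennreal_mult split: split_indicator)
  qed
qed

end

theory Submission
  imports Defs
begin

text \<open>
  Write \<open>U g x = \<integral> g dP(x)\<close> for functions with values in \<open>[0,\<infinity>]\<close>. Reversibility says
  \<open>\<integral> f U(g) d\<nu> = \<integral> U(f) g d\<nu>\<close> for indicators. For a fixed \<open>g\<close> both sides are integrals of \<open>f\<close>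
  against a measure, so the identity passes from indicators to all nonnegative \<open>f\<close>, and then
  to all nonnegative \<open>g\<close>; no integrability is needed. Iterating it gives the statements on
  powers of \<open>P\<close>, and \<open>f = 1\<close> gives \<open>\<nu>P = \<nu>\<close>, whence \<open>P\<close> is a contraction of \<open>L\<^sup>2(\<nu>)\<close> by Jensen's
  inequality. The signed statements follow by splitting into positive and negative parts.
  Conversely, self-adjointness yields reversibility on sets of finite measure, and \<open>\<sigma>\<close>-finiteness
  extends it to all sets.
\<close>

text \<open>Values in [0,\<infinity>] make this integral total, whereas the Bochner integral in
  \<open>markov_op\<close> is 0 by convention where it diverges. The identities are therefore proved
  for this operator first.\<close>

definition kernel_op :: "('a \<Rightarrow> 'a measure) \<Rightarrow> ('a \<Rightarrow> ennreal) \<Rightarrow> 'a \<Rightarrow> ennreal" where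
  "kernel_op P g x = (\<integral>\<^sup>+y. g y \<partial>P x)"

text \<open>This is reversibility with the weight absorbed into the measure: \<open>N\<close> will
  be \<open>\<nu>\<close>. In this form no density occurs, and the facts below hold for an arbitrary
  measure.\<close>

definition detailed_balance :: "'a measure \<Rightarrow> ('a \<Rightarrow> 'a measure) \<Rightarrow> bool" where
  "detailed_balance N P \<longleftrightarrow>
     (\<forall>A\<in>sets N. \<forall>B\<in>sets N.
        (\<integral>\<^sup>+x. indicator B x * emeasure (P x) A \<partial>N) = (\<integral>\<^sup>+x. indicator A x * emeasure (P x) B \<partial>N))"

section \<open>Detailed balance tested on nonnegative functions\<close>

context
  fixes N :: "'a measure" and P :: "'a \<Rightarrow> 'a measure"
  assumes P: "P \<in> N \<rightarrow>\<^sub>M prob_algebra N"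
begin

lemma kernel_props:
  assumes "x \<in> space N"
  shows "prob_space (P x)" "sets (P x) = sets N" "space (P x) = space N"
  using measurable_space[OF P assms] by (auto simp: space_prob_algebra dest: sets_eq_imp_space_eq)

lemma measurable_kernel_op:
  assumes [measurable]: "g \<in> borel_measurable N"
  shows "kernel_op P g \<in> borel_measurable N"
  using measurable_prob_algebraD[OF P] unfolding kernel_op_def by measurable

lemma measurable_markov_op:
  assumes [measurable]: "g \<in> borel_measurable N"
  shows "markov_op P g \<in> borel_measurable N"
  using measurable_prob_algebraD[OF P] unfolding markov_op_def by measurable

lemma kernel_op_indicator:
  "x \<in> space N \<Longrightarrow> A \<in> sets N \<Longrightarrow> kernel_op P (indicator A) x = emeasure (P x) A"
  by (simp add: kernel_op_def kernel_props)

lemma kernel_op_const: "x \<in> space N \<Longrightarrow> kernel_op P (\<lambda>_. a) x = a"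
  using prob_space.emeasure_space_1[OF kernel_props(1)] by (simp add: kernel_op_def)

lemma kernel_op_cong:
  assumes "x \<in> space N" "\<And>y. y \<in> space N \<Longrightarrow> f y = g y"
  shows "kernel_op P f x = kernel_op P g x"
  unfolding kernel_op_def using assms kernel_props(3) by (intro nn_integral_cong) auto

text \<open>The hypothesis says that the measures \<open>(g N)P\<close> and \<open>h N\<close> coincide.\<close>

lemma nn_integral_kernel_op_eqI:
  assumes [measurable]: "f \<in> borel_measurable N" "g \<in> borel_measurable N" "h \<in> borel_measurable N"
    and eq: "\<And>A. A \<in> sets N \<Longrightarrow>
      (\<integral>\<^sup>+x. g x * emeasure (P x) A \<partial>N) = (\<integral>\<^sup>+x. indicator A x * h x \<partial>N)"
  shows "(\<integral>\<^sup>+x. g x * kernel_op P f x \<partial>N) = (\<integral>\<^sup>+x. f x * h x \<partial>N)"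
\<comment> \<open>\<open>sets_bind\<close> and \<open>emeasure_bind\<close> require a nonempty
  space, so the empty one, where both integrals vanish, is treated apart.\<close>
proof (cases "space N = {}")
  case True
  then show ?thesis by (simp add: nn_integral_empty)
next
  case False
  note [measurable] = measurable_prob_algebraD[OF P] measurable_kernel_op
  have P': "P \<in> density N g \<rightarrow>\<^sub>M subprob_algebra N" by measurable
  have "density N g \<bind> P = density N h"
  proof (rule measure_eqI)
    show sets: "sets (density N g \<bind> P) = sets (density N h)"
      using sets_bind[of "density N g" P N] kernel_props(2) False by simp
    fix A assume "A \<in> sets (density N g \<bind> P)"
    then have [measurable]: "A \<in> sets N" using sets by simp
    have "emeasure (density N g \<bind> P) A = (\<integral>\<^sup>+x. g x * emeasure (P x) A \<partial>N)"
      using False by (simp add: emeasure_bind[OF _ P'] nn_integral_density)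
    also have "\<dots> = emeasure (density N h) A"
      by (simp add: eq emeasure_density mult.commute)
    finally show "emeasure (density N g \<bind> P) A = emeasure (density N h) A" .
  qed
  then have "(\<integral>\<^sup>+x. f x \<partial>(density N g \<bind> P)) = (\<integral>\<^sup>+x. f x \<partial>density N h)" by simp
  moreover have "(\<integral>\<^sup>+x. f x \<partial>(density N g \<bind> P)) = (\<integral>\<^sup>+x. g x * kernel_op P f x \<partial>N)"
    unfolding nn_integral_bind[OF assms(1) P']
    by (subst nn_integral_density) (simp_all add: kernel_op_def flip: kernel_op_def)
  ultimately show ?thesis by (simp add: nn_integral_density mult.commute)
qed

text \<open>The previous lemma is applied twice. With weight \<open>indicator B\<close> it replaces
  the other set by \<open>f\<close>; the resulting identity, read with weight \<open>f\<close>, is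
  the hypothesis needed to replace \<open>B\<close> by \<open>g\<close>.\<close>

lemma detailed_balance_nn_integral:
  assumes db: "detailed_balance N P"
    and [measurable]: "f \<in> borel_measurable N" "g \<in> borel_measurable N"
  shows "(\<integral>\<^sup>+x. f x * kernel_op P g x \<partial>N) = (\<integral>\<^sup>+x. kernel_op P f x * g x \<partial>N)"
proof -
  note [measurable] = measurable_prob_algebraD[OF P] measurable_kernel_op
  have "(\<integral>\<^sup>+x. indicator B x * kernel_op P f x \<partial>N) = (\<integral>\<^sup>+x. f x * emeasure (P x) B \<partial>N)"
    if [measurable]: "B \<in> sets N" for B
    using db that by (intro nn_integral_kernel_op_eqI) (auto simp: detailed_balance_def)
  then have "(\<integral>\<^sup>+x. f x * kernel_op P g x \<partial>N) = (\<integral>\<^sup>+x. g x * kernel_op P f x \<partial>N)"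
    by (intro nn_integral_kernel_op_eqI) auto
  then show ?thesis by (simp add: mult.commute)
qed

text \<open>Invariance of \<open>N\<close> in integral form: a probability kernel fixes the constant
  1. This is the source of the almost-everywhere finiteness and of the L2 bounds below.\<close>

lemma nn_integral_kernel_op:
  assumes "detailed_balance N P" and [measurable]: "f \<in> borel_measurable N"
  shows "(\<integral>\<^sup>+x. kernel_op P f x \<partial>N) = (\<integral>\<^sup>+x. f x \<partial>N)"
proof -
  have "(\<integral>\<^sup>+x. kernel_op P f x \<partial>N) = (\<integral>\<^sup>+x. kernel_op P (\<lambda>_. 1) x * f x \<partial>N)"
    using detailed_balance_nn_integral[OF assms(1), of "\<lambda>_. 1" f] by simp
  also have "\<dots> = (\<integral>\<^sup>+x. f x \<partial>N)"
    by (intro nn_integral_cong) (simp add: kernel_op_const)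
  finally show ?thesis .
qed

section \<open>Powers of the operator and iterated kernels\<close>

lemma measurable_kernel_op_funpow:
  "f \<in> borel_measurable N \<Longrightarrow> (kernel_op P ^^ n) f \<in> borel_measurable N"
  by (induction n) (auto intro: measurable_kernel_op)

text \<open>One factor crosses over to \<open>f\<close>, and the induction hypothesis for
  \<open>kernel_op P f\<close> moves the others; this is why \<open>f\<close> is generalized. At the
  end the new factor sits innermost, and \<open>funpow_swap1\<close> brings it outside.\<close>

lemma detailed_balance_funpow:
  assumes db: "detailed_balance N P"
    and "f \<in> borel_measurable N" "g \<in> borel_measurable N"
  shows "(\<integral>\<^sup>+x. f x * (kernel_op P ^^ n) g x \<partial>N) = (\<integral>\<^sup>+x. (kernel_op P ^^ n) f x * g x \<partial>N)"
  using assms(2,3)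
proof (induction n arbitrary: f)
  case (Suc n)
  have "(\<integral>\<^sup>+x. f x * (kernel_op P ^^ Suc n) g x \<partial>N)
      = (\<integral>\<^sup>+x. kernel_op P f x * (kernel_op P ^^ n) g x \<partial>N)"
    using Suc.prems by (simp add: detailed_balance_nn_integral[OF db] measurable_kernel_op_funpow)
  also have "\<dots> = (\<integral>\<^sup>+x. (kernel_op P ^^ n) (kernel_op P f) x * g x \<partial>N)"
    using Suc.prems by (intro Suc.IH measurable_kernel_op)
  finally show ?case by (simp add: funpow_swap1)
qed simp

text \<open>Integrability rules out the case in which the Bochner integral is 0 by convention while
  the right-hand side is infinite.\<close>

lemma ennreal_markov_op:
  assumes "integrable (P x) f" "\<And>y. y \<in> space (P x) \<Longrightarrow> 0 \<le> f y"
  shows "ennreal (markov_op P f x) = kernel_op P (\<lambda>y. ennreal (f y)) x"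
  using assms by (simp add: markov_op_def kernel_op_def nn_integral_eq_integral)

text \<open>The bounds 0 and 1 are carried through the induction because they make each power
  integrable against the probability measure \<open>P x\<close>, so that the two kinds of integral
  agree at the next step.\<close>

lemma ennreal_markov_op_funpow:
  assumes x: "x \<in> space N" and B: "B \<in> sets N"
  shows "ennreal ((markov_op P ^^ n) (indicator B) x) = (kernel_op P ^^ n) (indicator B) x
    \<and> 0 \<le> (markov_op P ^^ n) (indicator B) x \<and> (markov_op P ^^ n) (indicator B) x \<le> 1"
  using x
proof (induction n arbitrary: x)
  case 0
  show ?case by (simp split: split_indicator)
next
  case (Suc n)
  let ?f = "(markov_op P ^^ n) (indicator B)"
  interpret prob_space "P x" by (rule kernel_props[OF Suc.prems])
  have f[measurable]: "?f \<in> borel_measurable N"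
    using B by (induction n) (auto intro: measurable_markov_op)
  have [measurable]: "?f \<in> borel_measurable (P x)"
    using f kernel_props(2)[OF Suc.prems] by (simp cong: measurable_cong_sets)
  have AE: "AE y in P x. 0 \<le> ?f y \<and> ?f y \<le> 1"
    using Suc.IH kernel_props(3)[OF Suc.prems] by (intro AE_I2) auto
  have int: "integrable (P x) ?f"
    using AE by (intro integrable_const_bound[where B = 1]) auto
  have "ennreal (markov_op P ?f x) = (\<integral>\<^sup>+y. ennreal (?f y) \<partial>P x)"
    unfolding markov_op_def[of P ?f] using AE int by (intro nn_integral_eq_integral[symmetric]) auto
  also have "\<dots> = kernel_op P ((kernel_op P ^^ n) (indicator B)) x"
    unfolding kernel_op_def[of P _ x]
    using Suc.IH kernel_props(3)[OF Suc.prems] by (intro nn_integral_cong) auto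
  finally have "ennreal (markov_op P ?f x) = kernel_op P ((kernel_op P ^^ n) (indicator B)) x" .
  moreover have "0 \<le> markov_op P ?f x" "markov_op P ?f x \<le> 1"
    using AE int unfolding markov_op_def[of P ?f]
    by (auto intro!: integral_nonneg_AE integral_le_const)
  ultimately show ?case by simp
qed

text \<open>Connects the two ways of iterating, Giry binds of kernels and powers of the operator.
  The index is \<open>Suc n\<close> because \<open>iterated_kernel\<close> starts at 1.\<close>

lemma emeasure_iterated_kernel_funpow:
  assumes x: "x \<in> space N" and B: "B \<in> sets N"
  shows "emeasure (iterated_kernel P (Suc n) x) B = (kernel_op P ^^ Suc n) (indicator B) x"
  using x
proof (induction n arbitrary: x)
  case 0
  then show ?case by (simp add: kernel_op_indicator[OF _ B])
next
  case (Suc n)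
  have "emeasure (iterated_kernel P (Suc (Suc n)) x) B
      = kernel_op P (\<lambda>y. emeasure (iterated_kernel P (Suc n) y) B) x"
    \<comment> \<open>The fact comes from a context with a density \<open>c\<close>; a constant
      function is supplied for it.\<close>
    using emeasure_iterated_kernel_Suc[OF borel_measurable_const P Suc.prems B]
    by (simp add: kernel_op_def)
  also have "\<dots> = kernel_op P ((kernel_op P ^^ Suc n) (indicator B)) x"
    using Suc.IH by (intro kernel_op_cong Suc.prems)
  finally show ?case by simp
qed

lemma detailed_balance_iterated_kernel:
  assumes "detailed_balance N P"
  shows "detailed_balance N (iterated_kernel P (Suc n))"
  unfolding detailed_balance_def
proof (intro ballI)
  fix A B assume A: "A \<in> sets N" and B: "B \<in> sets N"
  have "(\<integral>\<^sup>+x. indicator B x * emeasure (iterated_kernel P (Suc n) x) A \<partial>N)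
      = (\<integral>\<^sup>+x. indicator B x * (kernel_op P ^^ Suc n) (indicator A) x \<partial>N)"
    by (intro nn_integral_cong) (simp only: emeasure_iterated_kernel_funpow[OF _ A])
  also have "\<dots> = (\<integral>\<^sup>+x. (kernel_op P ^^ Suc n) (indicator B) x * indicator A x \<partial>N)"
    using A B by (intro detailed_balance_funpow assms) auto
  also have "\<dots> = (\<integral>\<^sup>+x. indicator A x * emeasure (iterated_kernel P (Suc n) x) B \<partial>N)"
    by (intro nn_integral_cong) (simp only: emeasure_iterated_kernel_funpow[OF _ B] mult.commute)
  finally show "(\<integral>\<^sup>+x. indicator B x * emeasure (iterated_kernel P (Suc n) x) A \<partial>N)
      = (\<integral>\<^sup>+x. indicator A x * emeasure (iterated_kernel P (Suc n) x) B \<partial>N)" .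
qed

section \<open>Real-valued functions\<close>

lemma detailed_balance_integral_nonneg:
  assumes db: "detailed_balance N P"
    and [measurable]: "f \<in> borel_measurable N" "g \<in> borel_measurable N"
    and nonneg: "\<And>x. 0 \<le> f x" "\<And>x. 0 \<le> g x"
    and int: "AE x in N. integrable (P x) f" "AE x in N. integrable (P x) g"
    and fin: "(\<integral>\<^sup>+x. ennreal (f x) * kernel_op P (\<lambda>y. ennreal (g y)) x \<partial>N) < \<infinity>"
  shows "integrable N (\<lambda>x. f x * markov_op P g x)" "integrable N (\<lambda>x. markov_op P f x * g x)"
    "(\<integral>x. f x * markov_op P g x \<partial>N) = (\<integral>x. markov_op P f x * g x \<partial>N)"
proof -
  note [measurable] = measurable_markov_op
  have P0: "0 \<le> markov_op P f x" "0 \<le> markov_op P g x" for x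
    using nonneg by (simp_all add: markov_op_def)
  \<comment> \<open>At almost every \<open>x\<close> the function \<open>g\<close> is integrable
    against \<open>P x\<close>, so \<open>markov_op\<close> and \<open>kernel_op\<close> agree
    there.\<close>
  have 1: "(\<integral>\<^sup>+x. ennreal (f x * markov_op P g x) \<partial>N)
      = (\<integral>\<^sup>+x. ennreal (f x) * kernel_op P (\<lambda>y. ennreal (g y)) x \<partial>N)"
    using int(2) by (intro nn_integral_cong_AE, eventually_elim)
      (simp add: ennreal_mult nonneg P0 ennreal_markov_op)
  have 2: "(\<integral>\<^sup>+x. ennreal (markov_op P f x * g x) \<partial>N)
      = (\<integral>\<^sup>+x. kernel_op P (\<lambda>y. ennreal (f y)) x * ennreal (g x) \<partial>N)"
    using int(1) by (intro nn_integral_cong_AE, eventually_elim)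
      (simp add: ennreal_mult nonneg P0 ennreal_markov_op)
  have 3: "(\<integral>\<^sup>+x. ennreal (f x) * kernel_op P (\<lambda>y. ennreal (g y)) x \<partial>N)
      = (\<integral>\<^sup>+x. kernel_op P (\<lambda>y. ennreal (f y)) x * ennreal (g x) \<partial>N)"
    by (intro detailed_balance_nn_integral db) measurable
  \<comment> \<open>The symmetry \<open>3\<close> transports the finiteness in \<open>fin\<close> to
    the other side, which gives the second integrability.\<close>
  show "integrable N (\<lambda>x. f x * markov_op P g x)" "integrable N (\<lambda>x. markov_op P f x * g x)"
    using fin 1 2 3 by (auto intro!: integrableI_nonneg simp: nonneg P0)
  show "(\<integral>x. f x * markov_op P g x \<partial>N) = (\<integral>x. markov_op P f x * g x \<partial>N)"
    by (subst (1 2) integral_eq_nn_integral) (auto simp: nonneg P0 1 2 3)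
qed

text \<open>Splitting \<open>f\<close> and \<open>g\<close> into positive and negative parts leaves
  four nonnegative pairs, each dominated by the pair of absolute values in
  \<open>fin\<close>.\<close>

lemma detailed_balance_integral:
  assumes db: "detailed_balance N P"
    and [measurable]: "f \<in> borel_measurable N" "g \<in> borel_measurable N"
    and int: "AE x in N. integrable (P x) f" "AE x in N. integrable (P x) g"
    and fin: "(\<integral>\<^sup>+x. ennreal \<bar>f x\<bar> * kernel_op P (\<lambda>y. ennreal \<bar>g y\<bar>) x \<partial>N) < \<infinity>"
  shows "(\<integral>x. f x * markov_op P g x \<partial>N) = (\<integral>x. markov_op P f x * g x \<partial>N)"
proof -
  note [measurable] = measurable_markov_op
  define pos neg :: "('a \<Rightarrow> real) \<Rightarrow> 'a \<Rightarrow> real"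
    where "pos f x = max 0 (f x)" and "neg f x = max 0 (- f x)" for f x
  note pn = pos_def neg_def
  have [measurable]: "pos h \<in> borel_measurable N" "neg h \<in> borel_measurable N"
    if [measurable]: "h \<in> borel_measurable N" for h
    unfolding pn by measurable
  have intpn: "AE x in N. integrable (P x) (pos h)" "AE x in N. integrable (P x) (neg h)"
    if "AE x in N. integrable (P x) h" for h
    using that unfolding pn by (eventually_elim, simp)+
  have split: "AE x in N. markov_op P h x = markov_op P (pos h) x - markov_op P (neg h) x"
    if int: "AE x in N. integrable (P x) h" for h
    using int intpn[OF int]
  proof eventually_elim
    case (elim x)
    have "markov_op P h x = (\<integral>y. pos h y - neg h y \<partial>P x)"
      unfolding markov_op_def by (intro Bochner_Integration.integral_cong) (auto simp: pn)
    then show ?case using elim by (simp add: markov_op_def)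
  qed
  have *: "integrable N (\<lambda>x. f' x * markov_op P g' x)" "integrable N (\<lambda>x. markov_op P f' x * g' x)"
    "(\<integral>x. f' x * markov_op P g' x \<partial>N) = (\<integral>x. markov_op P f' x * g' x \<partial>N)"
    if "f' \<in> {pos f, neg f}" "g' \<in> {pos g, neg g}" for f' g'
  proof -
    have le: "0 \<le> f' x" "0 \<le> g' x" "f' x \<le> \<bar>f x\<bar>" "g' x \<le> \<bar>g x\<bar>" for x
      using that by (auto simp: pn)
    have m: "f' \<in> borel_measurable N" "g' \<in> borel_measurable N"
      using that by auto
    have i: "AE x in N. integrable (P x) f'" "AE x in N. integrable (P x) g'"
      using that intpn[OF int(1)] intpn[OF int(2)] by blast+
    have "(\<integral>\<^sup>+x. ennreal (f' x) * kernel_op P (\<lambda>y. ennreal (g' y)) x \<partial>N)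
        \<le> (\<integral>\<^sup>+x. ennreal \<bar>f x\<bar> * kernel_op P (\<lambda>y. ennreal \<bar>g y\<bar>) x \<partial>N)"
      unfolding kernel_op_def by (intro nn_integral_mono mult_mono ennreal_leI le) auto
    then have "(\<integral>\<^sup>+x. ennreal (f' x) * kernel_op P (\<lambda>y. ennreal (g' y)) x \<partial>N) < \<infinity>"
      using fin by (rule le_less_trans)
    from detailed_balance_integral_nonneg[OF db m le(1,2) i this]
    show "integrable N (\<lambda>x. f' x * markov_op P g' x)" "integrable N (\<lambda>x. markov_op P f' x * g' x)"
      "(\<integral>x. f' x * markov_op P g' x \<partial>N) = (\<integral>x. markov_op P f' x * g' x \<partial>N)" .
  qed
  have fg: "f x = pos f x - neg f x" "g x = pos g x - neg g x" for x
    by (simp_all add: pn)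
  have "(\<integral>x. f x * markov_op P g x \<partial>N) =
      (\<integral>x. pos f x * markov_op P (pos g) x - pos f x * markov_op P (neg g) x
         - (neg f x * markov_op P (pos g) x - neg f x * markov_op P (neg g) x) \<partial>N)"
  proof (rule integral_cong_AE)
    show "AE x in N. f x * markov_op P g x =
        pos f x * markov_op P (pos g) x - pos f x * markov_op P (neg g) x
         - (neg f x * markov_op P (pos g) x - neg f x * markov_op P (neg g) x)"
      using split[OF int(2)]
      by eventually_elim (simp only: fg left_diff_distrib, simp only: right_diff_distrib)
  qed measurable
  also have "\<dots> = (\<integral>x. markov_op P (pos f) x * pos g x - markov_op P (pos f) x * neg g x
         - (markov_op P (neg f) x * pos g x - markov_op P (neg f) x * neg g x) \<partial>N)"
    \<comment> \<open>The eight integrability facts in \<open>*\<close> justify linearity on both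
      sides; its equations then swap the four products one by one.\<close>
    by (simp add: *)
  also have "\<dots> = (\<integral>x. markov_op P f x * g x \<partial>N)"
  proof (rule integral_cong_AE)
    show "AE x in N. markov_op P (pos f) x * pos g x - markov_op P (pos f) x * neg g x
         - (markov_op P (neg f) x * pos g x - markov_op P (neg f) x * neg g x)
        = markov_op P f x * g x"
      using split[OF int(1)]
      by eventually_elim (simp only: fg left_diff_distrib, simp only: right_diff_distrib)
  qed measurable
  finally show ?thesis .
qed

section \<open>Invariance of the measure and the action on L2\<close>

lemma detailed_balance_measure_kernel:
  assumes "detailed_balance N P"
  shows "measure_kernel N P = N"
proof (rule measure_eqI)
  show sets: "sets (measure_kernel N P) = sets N"
    using sets.sigma_sets_eq[of N] sets.space_closed[of N] by (simp add: measure_kernel_def)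
  fix A assume "A \<in> sets (measure_kernel N P)"
  with sets have A: "A \<in> sets N" by simp
  have "emeasure (measure_kernel N P) A = (\<integral>\<^sup>+x. kernel_op P (indicator A) x \<partial>N)"
    unfolding emeasure_measure_kernel[OF borel_measurable_const P refl A]
    using ennreal_markov_op_funpow[OF _ A, of _ 1] by (intro nn_integral_cong) simp
  also have "\<dots> = emeasure N A"
    using A by (simp add: nn_integral_kernel_op[OF assms])
  finally show "emeasure (measure_kernel N P) A = emeasure N A" .
qed

text \<open>By invariance, the \<open>kernel_op\<close> image of the square of \<open>f\<close> has
  finite integral, hence is finite almost everywhere. On a probability space square-integrability
  implies integrability.\<close>

lemma AE_integrable_square_kernel:
  assumes db: "detailed_balance N P" and f: "f \<in> square_integrable N"
  shows "AE x in N. integrable (P x) f" "AE x in N. integrable (P x) (\<lambda>y. (f y)\<^sup>2)"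
proof -
  have [measurable]: "f \<in> borel_measurable N" and int: "integrable N (\<lambda>x. (f x)\<^sup>2)"
    using f by (auto simp: square_integrable_def)
  note [measurable] = measurable_kernel_op
  have "(\<integral>\<^sup>+x. kernel_op P (\<lambda>y. ennreal ((f y)\<^sup>2)) x \<partial>N) < \<infinity>"
    using int by (subst nn_integral_kernel_op[OF db]) (simp_all add: nn_integral_eq_integral)
  then have "AE x in N. kernel_op P (\<lambda>y. ennreal ((f y)\<^sup>2)) x \<noteq> \<infinity>"
    by (intro nn_integral_PInf_AE) auto
  then have *: "AE x in N. integrable (P x) (\<lambda>y. (f y)\<^sup>2) \<and> integrable (P x) f"
    using AE_space
  proof eventually_elim
    case (elim x)
    interpret prob_space "P x" by (rule kernel_props[OF elim(2)])
    note [measurable_cong] = kernel_props(2)[OF elim(2)]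
    have [measurable]: "f \<in> borel_measurable (P x)" by measurable
    have int: "integrable (P x) (\<lambda>y. (f y)\<^sup>2)"
      using elim(1) by (intro integrableI_nonneg) (auto simp: kernel_op_def less_top)
    moreover have "integrable (P x) f"
      by (rule square_integrable_imp_integrable[OF _ int]) measurable
    ultimately show ?case by blast
  qed
  then show "AE x in N. integrable (P x) f" "AE x in N. integrable (P x) (\<lambda>y. (f y)\<^sup>2)"
    by auto
qed

lemma nn_integral_markov_op_square:
  assumes db: "detailed_balance N P" and f: "f \<in> square_integrable N"
  shows "(\<integral>\<^sup>+x. ennreal ((markov_op P f x)\<^sup>2) \<partial>N) \<le> (\<integral>\<^sup>+x. ennreal ((f x)\<^sup>2) \<partial>N)"
proof -
  have [measurable]: "f \<in> borel_measurable N"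
    using f by (auto simp: square_integrable_def)
  have "(\<integral>\<^sup>+x. ennreal ((markov_op P f x)\<^sup>2) \<partial>N)
      \<le> (\<integral>\<^sup>+x. kernel_op P (\<lambda>y. ennreal ((f y)\<^sup>2)) x \<partial>N)"
  proof (rule nn_integral_mono_AE)
    show "AE x in N. ennreal ((markov_op P f x)\<^sup>2) \<le> kernel_op P (\<lambda>y. ennreal ((f y)\<^sup>2)) x"
      using AE_integrable_square_kernel[OF db f] AE_space
    proof eventually_elim
      case (elim x)
      interpret prob_space "P x" by (rule kernel_props[OF elim(3)])
      have "(markov_op P f x)\<^sup>2 \<le> markov_op P (\<lambda>y. (f y)\<^sup>2) x"
        \<comment> \<open>Jensen's inequality for the square: the variance of \<open>f\<close> under
          \<open>P x\<close> is nonnegative.\<close>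
        using variance_eq[OF elim(1,2)] variance_positive[of f] by (simp add: markov_op_def)
      then show ?case
        using ennreal_markov_op[OF elim(2)] by (metis ennreal_leI zero_le_power2)
    qed
  qed
  also have "\<dots> = (\<integral>\<^sup>+x. ennreal ((f x)\<^sup>2) \<partial>N)"
    by (rule nn_integral_kernel_op[OF db]) measurable
  finally show ?thesis .
qed

lemma markov_op_square_integrable:
  assumes db: "detailed_balance N P" and f: "f \<in> square_integrable N"
  shows "markov_op P f \<in> square_integrable N"
    "L2_inner N (markov_op P f) (markov_op P f) \<le> L2_inner N f f"
proof -
  note [measurable] = measurable_markov_op
  have [measurable]: "f \<in> borel_measurable N" and int: "integrable N (\<lambda>x. (f x)\<^sup>2)"
    using f by (auto simp: square_integrable_def)
  have fin: "(\<integral>\<^sup>+x. ennreal ((f x)\<^sup>2) \<partial>N) < \<infinity>"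
    using int by (simp add: nn_integral_eq_integral)
  have le: "(\<integral>\<^sup>+x. ennreal ((markov_op P f x)\<^sup>2) \<partial>N) \<le> (\<integral>\<^sup>+x. ennreal ((f x)\<^sup>2) \<partial>N)"
    by (rule nn_integral_markov_op_square[OF db f])
  then show "markov_op P f \<in> square_integrable N"
    using fin unfolding square_integrable_def by (auto intro!: integrableI_nonneg)
  show "L2_inner N (markov_op P f) (markov_op P f) \<le> L2_inner N f f"
    unfolding L2_inner_def power2_eq_square[symmetric]
    using le fin by (subst (1 2) integral_eq_nn_integral) (auto intro!: enn2real_mono)
qed

text \<open>Makes \<open>P\<close> well defined on classes of functions. By invariance |f - g| still
  has integral 0 after \<open>kernel_op\<close>, so for almost every \<open>x\<close> the functions
  agree \<open>P x\<close>-almost everywhere.\<close>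

lemma markov_op_cong_AE:
  assumes db: "detailed_balance N P"
    and [measurable]: "f \<in> borel_measurable N" "g \<in> borel_measurable N"
    and eq: "AE x in N. f x = g x"
  shows "AE x in N. markov_op P f x = markov_op P g x"
proof -
  note [measurable] = measurable_kernel_op
  have "(\<integral>\<^sup>+x. kernel_op P (\<lambda>y. ennreal \<bar>f y - g y\<bar>) x \<partial>N) = (\<integral>\<^sup>+x. ennreal \<bar>f x - g x\<bar> \<partial>N)"
    by (rule nn_integral_kernel_op[OF db]) measurable
  also have "\<dots> = (\<integral>\<^sup>+x. 0 \<partial>N)"
    using eq by (intro nn_integral_cong_AE) auto
  finally have "AE x in N. kernel_op P (\<lambda>y. ennreal \<bar>f y - g y\<bar>) x = 0"
    by (subst nn_integral_0_iff_AE[symmetric]) auto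
  then show ?thesis
    using AE_space
  proof eventually_elim
    case (elim x)
    note [measurable_cong] = kernel_props(2)[OF elim(2)]
    have "AE y in P x. ennreal \<bar>f y - g y\<bar> = 0"
      using elim(1) unfolding kernel_op_def by (subst (asm) nn_integral_0_iff_AE) auto
    then have "AE y in P x. f y = g y" by eventually_elim simp
    then show ?case unfolding markov_op_def by (intro integral_cong_AE) auto
  qed
qed

lemma detailed_balance_markov_self_adjoint:
  assumes db: "detailed_balance N P"
  shows "markov_self_adjoint N P"
proof -
  note AE_int = AE_integrable_square_kernel(1)[OF db]
  have lin: "AE x in N. markov_op P (\<lambda>y. a * f y + b * g y) x = a * markov_op P f x + b * markov_op P g x"
    if "f \<in> square_integrable N" "g \<in> square_integrable N" for f g a b
    using AE_int[OF that(1)] AE_int[OF that(2)] by eventually_elim (simp add: markov_op_def)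
  have cong: "AE x in N. markov_op P f x = markov_op P g x"
    if "f \<in> square_integrable N" "g \<in> square_integrable N" "AE x in N. f x = g x" for f g
    using that by (intro markov_op_cong_AE db) (auto simp: square_integrable_def)
  have "bounded_L2_operator N (markov_op P)"
    unfolding bounded_L2_operator_def
    using lin cong markov_op_square_integrable[OF db]
    \<comment> \<open>The operator bound is 1, since \<open>P\<close> is a contraction.\<close>
    by (intro conjI ballI allI impI exI[of _ 1]) auto
  moreover have "L2_inner N f (markov_op P g) = L2_inner N (markov_op P f) g"
    if f: "f \<in> square_integrable N" and g: "g \<in> square_integrable N" for f g
  proof -
    have [measurable]: "f \<in> borel_measurable N" "g \<in> borel_measurable N"
      and int: "integrable N (\<lambda>x. (f x)\<^sup>2)" "integrable N (\<lambda>x. (g x)\<^sup>2)"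
      using f g by (auto simp: square_integrable_def)
    note [measurable] = measurable_kernel_op
    \<comment> \<open>Integrated against \<open>P x\<close> and then \<open>N\<close>, this bounds
      the double integral by the sum of the two squared norms, the second one by invariance. It
      yields the absolute convergence that \<open>detailed_balance_integral\<close> asks
      for.\<close>
    have fg: "\<bar>f x\<bar> * \<bar>g y\<bar> \<le> (f x)\<^sup>2 + (g y)\<^sup>2" for x y
      using sum_squares_bound[of "\<bar>f x\<bar>" "\<bar>g y\<bar>"] mult_nonneg_nonneg[of "\<bar>f x\<bar>" "\<bar>g y\<bar>"]
      unfolding power2_abs by linarith
    have "(\<integral>\<^sup>+x. ennreal \<bar>f x\<bar> * kernel_op P (\<lambda>y. ennreal \<bar>g y\<bar>) x \<partial>N)
        \<le> (\<integral>\<^sup>+x. ennreal ((f x)\<^sup>2) + kernel_op P (\<lambda>y. ennreal ((g y)\<^sup>2)) x \<partial>N)"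
    proof (rule nn_integral_mono)
      fix x assume x: "x \<in> space N"
      interpret prob_space "P x" by (rule kernel_props[OF x])
      note [measurable_cong] = kernel_props(2)[OF x]
      have "ennreal \<bar>f x\<bar> * kernel_op P (\<lambda>y. ennreal \<bar>g y\<bar>) x = (\<integral>\<^sup>+y. ennreal (\<bar>f x\<bar> * \<bar>g y\<bar>) \<partial>P x)"
        unfolding kernel_op_def by (simp add: nn_integral_cmult ennreal_mult)
      also have "\<dots> \<le> (\<integral>\<^sup>+y. ennreal ((f x)\<^sup>2) + ennreal ((g y)\<^sup>2) \<partial>P x)"
        using fg by (intro nn_integral_mono) (auto simp flip: ennreal_plus intro!: ennreal_leI)
      also have "\<dots> = ennreal ((f x)\<^sup>2) + kernel_op P (\<lambda>y. ennreal ((g y)\<^sup>2)) x"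
        unfolding kernel_op_def by (simp add: nn_integral_add emeasure_space_1)
      finally show "ennreal \<bar>f x\<bar> * kernel_op P (\<lambda>y. ennreal \<bar>g y\<bar>) x \<le> \<dots>" .
    qed
    also have "\<dots> = (\<integral>\<^sup>+x. ennreal ((f x)\<^sup>2) \<partial>N) + (\<integral>\<^sup>+x. ennreal ((g x)\<^sup>2) \<partial>N)"
      by (simp add: nn_integral_add nn_integral_kernel_op[OF db])
    also have "\<dots> < \<infinity>"
      using int by (simp add: nn_integral_eq_integral)
    finally show ?thesis
      unfolding L2_inner_def by (intro detailed_balance_integral db AE_int f g) auto
  qed
  ultimately show ?thesis
    unfolding markov_self_adjoint_def self_adjoint_on_L2_def using AE_int by blast
qed

end

section \<open>Passage to the weighted measure \<open>\<nu>\<close>\<close>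

context
  fixes M :: "'a measure" and c :: "'a \<Rightarrow> real" and P :: "'a \<Rightarrow> 'a measure" and \<nu> :: "'a measure"
  assumes c[measurable]: "c \<in> borel_measurable M" and c_pos: "\<And>x. x \<in> space M \<Longrightarrow> 0 < c x"
    and P: "P \<in> M \<rightarrow>\<^sub>M prob_algebra M"
    and nu: "\<nu> = density M (\<lambda>x. ennreal (c x))"
begin

lemma sets_nu [simp, measurable_cong]: "sets \<nu> = sets M"
  by (simp add: nu)

lemma space_nu [simp]: "space \<nu> = space M"
  by (simp add: nu)

text \<open>\<open>prob_algebra\<close> depends only on the sigma-algebra of its argument, which a
  density leaves unchanged. Thus the results for a general \<open>N\<close> apply to
  \<open>\<nu>\<close>.\<close>

lemma measurable_kernel_nu:
  "K \<in> M \<rightarrow>\<^sub>M prob_algebra M \<Longrightarrow> K \<in> \<nu> \<rightarrow>\<^sub>M prob_algebra \<nu>"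
  using sets_nu by (metis measurable_cong_sets prob_algebra_def subprob_algebra_cong)

lemma nn_integral_nu:
  assumes [measurable]: "f \<in> borel_measurable M"
  shows "(\<integral>\<^sup>+x. f x \<partial>\<nu>) = (\<integral>\<^sup>+x. ennreal (c x) * f x \<partial>M)"
  unfolding nu by (rule nn_integral_density) measurable

lemma integral_nu:
  fixes f :: "'a \<Rightarrow> real"
  assumes [measurable]: "f \<in> borel_measurable M"
  shows "(\<integral>x. f x \<partial>\<nu>) = (\<integral>x. c x * f x \<partial>M)"
  unfolding nu using c_pos by (subst integral_density) (auto intro!: AE_I2 less_imp_le)

text \<open>Stated for any kernel \<open>K\<close> so that it serves both \<open>P\<close> and its
  iterates.\<close>

lemma reversible_iff_detailed_balance:
  assumes "K \<in> M \<rightarrow>\<^sub>M prob_algebra M"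
  shows "reversible M c K \<longleftrightarrow> detailed_balance \<nu> K"
proof -
  note [measurable] = measurable_prob_algebraD[OF assms]
  have "(\<integral>\<^sup>+x. indicator B x * emeasure (K x) A \<partial>\<nu>)
      = (\<integral>\<^sup>+x\<in>B. ennreal (c x) * emeasure (K x) A \<partial>M)"
    if [measurable]: "A \<in> sets M" "B \<in> sets M" for A B
    by (subst nn_integral_nu) (simp_all add: ac_simps)
  then show ?thesis by (simp add: reversible_def detailed_balance_def)
qed

section \<open>Measures on the product space\<close>

lemma emeasure_edge_measure_nu:
  assumes [measurable]: "A \<in> sets M" "B \<in> sets M"
  shows "emeasure (edge_measure M c P) (A \<times> B) = (\<integral>\<^sup>+x. indicator A x * emeasure (P x) B \<partial>\<nu>)"
proof -
  note [measurable] = measurable_prob_algebraD[OF P]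
  show ?thesis
    by (simp add: emeasure_edge_measure_Times[OF c P] nn_integral_nu)
qed

text \<open>The two sides of detailed balance are the masses of a rectangle and of its mirror image.
  The other conditions on product measures are reduced to this one.\<close>

lemma detailed_balance_iff_edge_measure:
  "detailed_balance \<nu> P \<longleftrightarrow> symmetric_measure M (edge_measure M c P)"
  by (auto simp: detailed_balance_def symmetric_measure_def emeasure_edge_measure_nu)

lemma emeasure_reversed_edge_measure_Times:
  assumes "A \<in> sets M" "B \<in> sets M"
  shows "emeasure (reversed_edge_measure M c P) (A \<times> B) = emeasure (edge_measure M c P) (B \<times> A)"
proof -
  have "indicator (A \<times> B) (x, y) = (indicator (B \<times> A) (y, x) :: ennreal)" for x y
    by (simp add: indicator_def conj_commute)
  then show ?thesis
    using assms by (simp add: emeasure_edge_measure[OF c P] emeasure_reversed_edge_measure[OF c P])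
qed

text \<open>On rectangles the reversed measure is the mirror image of the edge measure. Since
  rectangles form an intersection-stable generator, agreement there extends to all measurable sets
  once the space is exhausted by rectangles of finite mass.\<close>

lemma detailed_balance_iff_edge_measure_eq:
  assumes "sigma_finite_measure \<nu>"
  shows "detailed_balance \<nu> P \<longleftrightarrow> edge_measure M c P = reversed_edge_measure M c P"
proof
  assume "edge_measure M c P = reversed_edge_measure M c P"
  then show "detailed_balance \<nu> P"
    unfolding detailed_balance_iff_edge_measure symmetric_measure_def
    by (metis emeasure_reversed_edge_measure_Times)
next
  assume sym: "detailed_balance \<nu> P"
  let ?E = "{A \<times> B | A B. A \<in> sets M \<and> B \<in> sets M}"
  interpret sigma_finite_measure \<nu> by fact
  obtain V :: "nat \<Rightarrow> 'a set" where V: "range V \<subseteq> sets M" "(\<Union>i. V i) = space M"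
      "\<And>i. emeasure \<nu> (V i) \<noteq> \<infinity>"
    using sigma_finite_incseq by simp metis
  show "edge_measure M c P = reversed_edge_measure M c P"
  proof (rule measure_eqI_generator_eq)
    show "Int_stable ?E" by (rule Int_stable_pair_measure_generator)
    show "?E \<subseteq> Pow (space M \<times> space M)" using sets.sets_into_space by fastforce
    show "emeasure (edge_measure M c P) X = emeasure (reversed_edge_measure M c P) X" if "X \<in> ?E" for X
      using that sym
      by (auto simp: detailed_balance_iff_edge_measure symmetric_measure_def
          emeasure_reversed_edge_measure_Times)
    show "sets (edge_measure M c P) = sigma_sets (space M \<times> space M) ?E"
      "sets (reversed_edge_measure M c P) = sigma_sets (space M \<times> space M) ?E"
      by (simp_all add: sets_pair_measure)
    show "range (\<lambda>i. V i \<times> space M) \<subseteq> ?E" using V by blast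
    show "(\<Union>i. V i \<times> space M) = space M \<times> space M" using V by blast
    fix i
    have [measurable]: "V i \<in> sets M" using V by auto
    \<comment> \<open>Each \<open>P x\<close> has total mass 1, so the strip over \<open>V i\<close>
      has mass \<open>emeasure \<nu> (V i)\<close>, finite by the choice of
      \<open>V\<close>.\<close>
    have "emeasure (edge_measure M c P) (V i \<times> space M) = (\<integral>\<^sup>+x. indicator (V i) x \<partial>\<nu>)"
      unfolding emeasure_edge_measure_nu[OF \<open>V i \<in> sets M\<close> sets.top]
    proof (rule nn_integral_cong)
      fix x assume "x \<in> space \<nu>"
      then have "prob_space (P x)" "space (P x) = space M"
        using kernel_props[OF P] by simp_all
      then show "indicator (V i) x * emeasure (P x) (space M) = indicator (V i) x"
        using prob_space.emeasure_space_1[of "P x"] by simp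
    qed
    then show "emeasure (edge_measure M c P) (V i \<times> space M) \<noteq> \<infinity>" using V by simp
  qed
qed

lemma detailed_balance_iff_rho:
  "detailed_balance \<nu> P \<longleftrightarrow> symmetric_measure M (rho M c P)"
proof -
  \<comment> \<open>Agreement on rectangles suffices, as \<open>symmetric_measure\<close> tests only
    these.\<close>
  have "emeasure (rho M c P) (A \<times> B) = emeasure (edge_measure M c P) (A \<times> B)"
    if A: "A \<in> sets M" and B: "B \<in> sets M" for A B
  proof (subst emeasure_rho[OF c _ P A B], erule c_pos,
      unfold emeasure_edge_measure_Times[OF c P A B], rule nn_integral_cong)
    fix x assume x: "x \<in> space M"
    have "ennreal (markov_op P (indicator B) x) = emeasure (P x) B" "0 \<le> markov_op P (indicator B) x"
      using ennreal_markov_op_funpow[OF P x B, of 1] by (auto simp: kernel_op_indicator[OF P x B])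
    then show "ennreal (indicator A x * R_op c P (indicator B) x)
        = ennreal (c x) * (indicator A x * emeasure (P x) B)"
      using c_pos[OF x] by (simp add: R_op_def ennreal_mult split: split_indicator)
  qed
  then show ?thesis
    by (simp add: detailed_balance_iff_edge_measure symmetric_measure_def)
qed

lemma emeasure_rho_n_kernel_op:
  assumes A: "A \<in> sets M" and B: "B \<in> sets M"
  shows "emeasure (rho_n M c P n) (A \<times> B)
    = (\<integral>\<^sup>+x. indicator A x * (kernel_op P ^^ n) (indicator B) x \<partial>\<nu>)"
  unfolding emeasure_rho_n[OF c P A B] nu[symmetric]
  using ennreal_markov_op_funpow[OF P _ B, of _ n]
  by (intro nn_integral_cong) (simp split: split_indicator)

lemma detailed_balance_iff_rho_n:
  "detailed_balance \<nu> P \<longleftrightarrow> (\<forall>n. symmetric_measure M (rho_n M c P n))"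
proof
  assume db: "detailed_balance \<nu> P"
  show "\<forall>n. symmetric_measure M (rho_n M c P n)"
    unfolding symmetric_measure_def
  proof (intro allI ballI)
    fix n A B assume A: "A \<in> sets M" and B: "B \<in> sets M"
    have "(\<integral>\<^sup>+x. indicator A x * (kernel_op P ^^ n) (indicator B) x \<partial>\<nu>)
        = (\<integral>\<^sup>+x. (kernel_op P ^^ n) (indicator A) x * indicator B x \<partial>\<nu>)"
      using A B by (intro detailed_balance_funpow[OF measurable_kernel_nu[OF P] db]) auto
    then show "emeasure (rho_n M c P n) (A \<times> B) = emeasure (rho_n M c P n) (B \<times> A)"
      by (simp add: emeasure_rho_n_kernel_op A B mult.commute)
  qed
next
  assume "\<forall>n. symmetric_measure M (rho_n M c P n)"
  \<comment> \<open>The first power is enough for the converse: its values on rectangles are those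
    of the edge measure.\<close>
  then have "symmetric_measure M (rho_n M c P 1)" ..
  moreover have "emeasure (rho_n M c P 1) (A \<times> B) = emeasure (edge_measure M c P) (A \<times> B)"
    if A: "A \<in> sets M" and B: "B \<in> sets M" for A B
    unfolding emeasure_rho_n_kernel_op[OF A B] emeasure_edge_measure_nu[OF A B]
    by (intro nn_integral_cong) (simp add: kernel_op_indicator[OF P _ B])
  ultimately show "detailed_balance \<nu> P"
    by (simp add: detailed_balance_iff_edge_measure symmetric_measure_def)
qed

section \<open>Iterated kernels, and detailed balance from self-adjointness\<close>

lemma reversible_iterated_kernel_iff:
  "reversible M c P \<longleftrightarrow> (\<forall>n\<ge>1. reversible M c (iterated_kernel P n))"
proof
  assume rev: "reversible M c P"
  show "\<forall>n\<ge>1. reversible M c (iterated_kernel P n)"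
  proof (intro allI impI)
    fix n :: nat assume "1 \<le> n"
    then obtain m where n: "n = Suc m" by (cases n) auto
    have "detailed_balance \<nu> (iterated_kernel P n)"
      using rev measurable_kernel_nu[OF P]
      by (simp add: n reversible_iff_detailed_balance[OF P] detailed_balance_iterated_kernel)
    then show "reversible M c (iterated_kernel P n)"
      using iterated_kernel_props[OF c P, of m] by (simp add: n reversible_iff_detailed_balance)
  qed
next
  assume "\<forall>n\<ge>1. reversible M c (iterated_kernel P n)"
  from this[rule_format, of "Suc 0"] show "reversible M c P" by simp
qed

text \<open>Indicators lie in L2 only for sets of finite \<open>\<nu>\<close>-measure, so
  self-adjointness is used on truncated sets and the general case follows by continuity from below
  of the edge measure.\<close>

lemma markov_self_adjoint_detailed_balance:
  assumes "sigma_finite_measure \<nu>" and sa: "markov_self_adjoint \<nu> P"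
  shows "detailed_balance \<nu> P"
  unfolding detailed_balance_iff_edge_measure symmetric_measure_def
proof (intro ballI)
  fix A B assume A[measurable]: "A \<in> sets M" and B[measurable]: "B \<in> sets M"
  let ?e = "edge_measure M c P"
  interpret sigma_finite_measure \<nu> by fact
  obtain V :: "nat \<Rightarrow> 'a set" where V: "range V \<subseteq> sets M" "(\<Union>i. V i) = space M"
      "\<And>i. emeasure \<nu> (V i) \<noteq> \<infinity>" "incseq V"
    using sigma_finite_incseq by simp metis
  have [measurable]: "V i \<in> sets M" for i using V(1) by auto
  have fin: "?e (S \<times> T) = ?e (T \<times> S)"
    if [measurable]: "S \<in> sets M" "T \<in> sets M" and "emeasure \<nu> S < \<infinity>" "emeasure \<nu> T < \<infinity>" for S T
  proof -
    note [measurable] = measurable_markov_op[OF P]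
    have "(\<lambda>x. (indicator X x :: real)\<^sup>2) = indicator X" for X :: "'a set"
      by (auto split: split_indicator)
    then have sq: "indicator S \<in> square_integrable \<nu>" "indicator T \<in> square_integrable \<nu>"
      using that by (simp_all add: square_integrable_def)
    \<comment> \<open>Finiteness of the first set makes the integrand integrable, because it is
      dominated by the indicator of that set; hence the real inner product is the edge mass.\<close>
    have e: "?e (S' \<times> T') = ennreal (L2_inner \<nu> (indicator S') (markov_op P (indicator T')))"
      if [measurable]: "S' \<in> sets M" and T'[measurable]: "T' \<in> sets M"
        and fin': "emeasure \<nu> S' < \<infinity>" for S' T'
    proof -
      have P1: "ennreal (markov_op P (indicator T') x) = emeasure (P x) T'"
        "0 \<le> markov_op P (indicator T') x" "markov_op P (indicator T') x \<le> 1" if "x \<in> space M" for x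
        using ennreal_markov_op_funpow[OF P that T', of 1] by (auto simp: kernel_op_indicator[OF P that T'])
      have "integrable \<nu> (\<lambda>x. indicator S' x * markov_op P (indicator T') x)"
      proof (rule Bochner_Integration.integrable_bound)
        show "integrable \<nu> (indicator S' :: 'a \<Rightarrow> real)"
          using fin' by simp
        show "AE x in \<nu>. norm (indicator S' x * markov_op P (indicator T') x) \<le> norm (indicator S' x :: real)"
          using P1(2,3) by (intro AE_I2) (simp split: split_indicator)
      qed measurable
      then have "ennreal (L2_inner \<nu> (indicator S') (markov_op P (indicator T')))
          = (\<integral>\<^sup>+x. ennreal (indicator S' x * markov_op P (indicator T') x) \<partial>\<nu>)"
        unfolding L2_inner_def using P1(2) by (intro nn_integral_eq_integral[symmetric]) auto
      also have "\<dots> = ?e (S' \<times> T')"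
        unfolding emeasure_edge_measure_nu[OF \<open>S' \<in> sets M\<close> T']
        using P1(1) by (intro nn_integral_cong) (simp split: split_indicator)
      finally show ?thesis by simp
    qed
    have "L2_inner \<nu> (indicator S) (markov_op P (indicator T))
        = L2_inner \<nu> (markov_op P (indicator S)) (indicator T)"
      using sa sq unfolding markov_self_adjoint_def self_adjoint_on_L2_def by blast
    also have "\<dots> = L2_inner \<nu> (indicator T) (markov_op P (indicator S))"
      unfolding L2_inner_def by (simp only: mult.commute)
    finally show ?thesis
      by (simp only: e[OF that(1,2,3)] e[OF that(2,1,4)])
  qed
  \<comment> \<open>Both factors are truncated by the same \<open>V i\<close>. As \<open>V\<close>
    increases, a point of the rectangle whose coordinates enter at stages \<open>i\<close> and
    \<open>j\<close> is captured at stage \<open>max i j\<close>.\<close>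
  have lim: "(\<lambda>i. ?e ((S \<inter> V i) \<times> (T \<inter> V i))) \<longlonglongrightarrow> ?e (S \<times> T)"
    if [measurable]: "S \<in> sets M" "T \<in> sets M" for S T
  proof -
    have "(\<Union>i. (S \<inter> V i) \<times> (T \<inter> V i)) = S \<times> T"
    proof (intro equalityI subsetI)
      fix z assume "z \<in> S \<times> T"
      then obtain x y where z: "z = (x, y)" "x \<in> S" "y \<in> T" by blast
      then have "x \<in> (\<Union>i. V i)" "y \<in> (\<Union>i. V i)"
        using sets.sets_into_space[OF that(1)] sets.sets_into_space[OF that(2)] V(2) by auto
      then obtain i j where "x \<in> V i" "y \<in> V j" by blast
      then have "x \<in> V (max i j)" "y \<in> V (max i j)"
        using incseqD[OF V(4)] by (meson max.cobounded1 max.cobounded2 subsetD)+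
      then show "z \<in> (\<Union>i. (S \<inter> V i) \<times> (T \<inter> V i))" using z by blast
    qed auto
    moreover have "incseq (\<lambda>i. (S \<inter> V i) \<times> (T \<inter> V i))"
      using incseqD[OF V(4)] by (fastforce simp: incseq_def)
    moreover have "range (\<lambda>i. (S \<inter> V i) \<times> (T \<inter> V i)) \<subseteq> sets ?e"
      unfolding sets_product_measures by (intro image_subsetI) measurable
    ultimately show ?thesis
      using Lim_emeasure_incseq[of "\<lambda>i. (S \<inter> V i) \<times> (T \<inter> V i)" ?e] by simp
  qed
  have small: "emeasure \<nu> (S \<inter> V i) < \<infinity>" if "S \<in> sets M" for S i
  proof (rule le_less_trans)
    show "emeasure \<nu> (S \<inter> V i) \<le> emeasure \<nu> (V i)"
      by (intro emeasure_mono) auto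
    show "emeasure \<nu> (V i) < \<infinity>"
      using V(3)[of i] by (simp add: less_top)
  qed
  have swap: "?e ((A \<inter> V i) \<times> (B \<inter> V i)) = ?e ((B \<inter> V i) \<times> (A \<inter> V i))" for i
    by (intro fin small A B) measurable
  show "?e (A \<times> B) = ?e (B \<times> A)"
    by (rule LIMSEQ_unique[OF lim[OF A B, unfolded swap] lim[OF B A]])
qed

section \<open>The operator \<open>R\<close>\<close>

lemma integrable_bounded_borel:
  assumes f: "f \<in> bounded_borel M" and x: "x \<in> space M"
  shows "integrable (P x) f"
proof -
  interpret prob_space "P x" by (rule kernel_props[OF P x])
  note [measurable_cong] = kernel_props(2)[OF P x]
  obtain K where [measurable]: "f \<in> borel_measurable M" and K: "\<And>y. y \<in> space M \<Longrightarrow> \<bar>f y\<bar> \<le> K"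
    using f by (auto simp: bounded_borel_def)
  show ?thesis
    using K kernel_props(3)[OF P x] by (intro integrable_const_bound[where B = K]) auto
qed

text \<open>The factor \<open>c\<close> of \<open>R_op\<close> becomes the density of
  \<open>\<nu>\<close>, and boundedness of \<open>g\<close> makes its Bochner integral against
  \<open>P x\<close> agree with the nonnegative one.\<close>

lemma nn_integral_R_op:
  assumes f: "f \<in> bounded_borel M" and g: "g \<in> bounded_borel M"
    and nonneg: "\<And>x. x \<in> space M \<Longrightarrow> 0 \<le> f x" "\<And>x. x \<in> space M \<Longrightarrow> 0 \<le> g x"
  shows "(\<integral>\<^sup>+x. ennreal (f x * R_op c P g x) \<partial>M)
    = (\<integral>\<^sup>+x. ennreal (f x) * kernel_op P (\<lambda>y. ennreal (g y)) x \<partial>\<nu>)"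
proof -
  have [measurable]: "f \<in> borel_measurable M" "g \<in> borel_measurable M"
    using f g by (auto simp: bounded_borel_def)
  note [measurable] = measurable_kernel_op[OF P]
  show ?thesis
  proof (subst nn_integral_nu, measurable, rule nn_integral_cong)
    fix x assume x: "x \<in> space M"
    have "ennreal (markov_op P g x) = kernel_op P (\<lambda>y. ennreal (g y)) x"
      using nonneg kernel_props(3)[OF P x] by (intro ennreal_markov_op[OF P] integrable_bounded_borel g x) auto
    moreover have "0 \<le> markov_op P g x"
      unfolding markov_op_def using nonneg kernel_props(3)[OF P x] by (intro integral_nonneg_AE AE_I2) auto
    ultimately show "ennreal (f x * R_op c P g x)
        = ennreal (c x) * (ennreal (f x) * kernel_op P (\<lambda>y. ennreal (g y)) x)"
      using nonneg x c_pos[OF x] by (simp add: R_op_def ennreal_mult ac_simps)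
  qed
qed

text \<open>Nonnegative functions are covered by the identity in [0,\<infinity>]. For signed ones
  the proviso in \<open>symmetric_operator\<close>, rewritten over \<open>\<nu>\<close>, is the
  finiteness condition of \<open>detailed_balance_integral\<close>.\<close>

lemma detailed_balance_symmetric_operator:
  assumes db: "detailed_balance \<nu> P"
  shows "symmetric_operator M (R_op c P)"
  unfolding symmetric_operator_def
proof (intro conjI ballI impI)
  fix f g assume f: "f \<in> bounded_borel M" and g: "g \<in> bounded_borel M"
  have [measurable]: "f \<in> borel_measurable M" "g \<in> borel_measurable M"
    using f g by (auto simp: bounded_borel_def)
  note P_nu = measurable_kernel_nu[OF P]
  {
    assume "\<forall>x\<in>space M. 0 \<le> f x \<and> 0 \<le> g x"
    then have nonneg: "\<And>x. x \<in> space M \<Longrightarrow> 0 \<le> f x" "\<And>x. x \<in> space M \<Longrightarrow> 0 \<le> g x" by auto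
    have "(\<integral>\<^sup>+x. ennreal (f x) * kernel_op P (\<lambda>y. ennreal (g y)) x \<partial>\<nu>)
        = (\<integral>\<^sup>+x. kernel_op P (\<lambda>y. ennreal (f y)) x * ennreal (g x) \<partial>\<nu>)"
      by (intro detailed_balance_nn_integral[OF P_nu db]) measurable
    then show "(\<integral>\<^sup>+x. ennreal (f x * R_op c P g x) \<partial>M) = (\<integral>\<^sup>+x. ennreal (R_op c P f x * g x) \<partial>M)"
      using nn_integral_R_op[OF f g nonneg] nn_integral_R_op[OF g f nonneg(2,1)]
      by (simp add: mult.commute)
  next
    assume int: "integrable M (\<lambda>x. \<bar>f x\<bar> * R_op c P (\<lambda>y. \<bar>g y\<bar>) x)"
    have abs: "(\<lambda>x. \<bar>f x\<bar>) \<in> bounded_borel M" "(\<lambda>x. \<bar>g x\<bar>) \<in> bounded_borel M"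
      using f g by (auto simp: bounded_borel_def)
    have "(\<integral>\<^sup>+x. ennreal (\<bar>f x\<bar> * R_op c P (\<lambda>y. \<bar>g y\<bar>) x) \<partial>M) < \<infinity>"
      using int by (auto simp: less_top[symmetric] dest!: integrableD(2)
        intro: le_less_trans[OF nn_integral_mono])
    then have fin: "(\<integral>\<^sup>+x. ennreal \<bar>f x\<bar> * kernel_op P (\<lambda>y. ennreal \<bar>g y\<bar>) x \<partial>\<nu>) < \<infinity>"
      by (simp add: nn_integral_R_op[OF abs])
    have "(\<integral>x. f x * markov_op P g x \<partial>\<nu>) = (\<integral>x. markov_op P f x * g x \<partial>\<nu>)"
      using f g integrable_bounded_borel
      by (intro detailed_balance_integral[OF P_nu db _ _ _ _ fin] AE_I2) auto
    then show "(\<integral>x. f x * R_op c P g x \<partial>M) = (\<integral>x. R_op c P f x * g x \<partial>M)"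
      using measurable_markov_op[OF P]
      by (simp add: integral_nu R_op_def ac_simps)
  }
qed

text \<open>The clause for nonnegative functions, evaluated at two indicators, is detailed
  balance.\<close>

lemma symmetric_operator_detailed_balance:
  assumes "symmetric_operator M (R_op c P)"
  shows "detailed_balance \<nu> P"
  unfolding detailed_balance_def
proof (intro ballI)
  fix A B assume "A \<in> sets \<nu>" "B \<in> sets \<nu>"
  then have A[measurable]: "A \<in> sets M" and B[measurable]: "B \<in> sets M" by simp_all
  have AB: "indicator A \<in> bounded_borel M" "indicator B \<in> bounded_borel M"
    by (auto simp: bounded_borel_def intro!: exI[of _ 1] split: split_indicator)
  have R: "(\<integral>\<^sup>+x. ennreal (indicator S x * R_op c P (indicator T) x) \<partial>M)
      = (\<integral>\<^sup>+x. indicator S x * emeasure (P x) T \<partial>\<nu>)"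
    if "S \<in> {A, B}" "T \<in> {A, B}" for S T
  proof -
    have "(\<integral>\<^sup>+x. ennreal (indicator S x * R_op c P (indicator T) x) \<partial>M)
        = (\<integral>\<^sup>+x. ennreal (indicator S x) * kernel_op P (\<lambda>y. ennreal (indicator T y)) x \<partial>\<nu>)"
      using that AB by (intro nn_integral_R_op) auto
    also have "\<dots> = (\<integral>\<^sup>+x. indicator S x * emeasure (P x) T \<partial>\<nu>)"
      using that A B by (intro nn_integral_cong) (auto simp: ennreal_indicator kernel_op_indicator[OF P])
    finally show ?thesis .
  qed
  have "(\<integral>\<^sup>+x. ennreal (indicator B x * R_op c P (indicator A) x) \<partial>M)
      = (\<integral>\<^sup>+x. ennreal (R_op c P (indicator B) x * indicator A x) \<partial>M)"
    using assms AB by (simp add: symmetric_operator_def)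
  then show "(\<integral>\<^sup>+x. indicator B x * emeasure (P x) A \<partial>\<nu>) = (\<integral>\<^sup>+x. indicator A x * emeasure (P x) B \<partial>\<nu>)"
    using R by (simp add: mult.commute)
qed

end

theorem theorem5p3:
  fixes M :: "'a measure" and c :: "'a \<Rightarrow> real" and P :: "'a \<Rightarrow> 'a measure" and \<nu> :: "'a measure"
  assumes "standard_borel_space M" and "sigma_finite_measure M" and "nonatomic M"
    and "c \<in> borel_measurable M" and "\<And>x. x \<in> space M \<Longrightarrow> 0 < c x" and "locally_integrable M c"
    and "P \<in> M \<rightarrow>\<^sub>M prob_algebra M"
    and "\<nu> = density M (\<lambda>x. ennreal (c x))"
  shows "(reversible M c P \<longleftrightarrow> (\<forall>n\<ge>1. reversible M c (iterated_kernel P n))) \<and>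
         (reversible M c P \<longleftrightarrow> markov_self_adjoint \<nu> P \<and> measure_kernel \<nu> P = \<nu>) \<and>
         (reversible M c P \<longleftrightarrow> edge_measure M c P = reversed_edge_measure M c P) \<and>
         (reversible M c P \<longleftrightarrow> symmetric_operator M (R_op c P)) \<and>
         (reversible M c P \<longleftrightarrow> symmetric_measure M (rho M c P)) \<and>
         (reversible M c P \<longleftrightarrow> (\<forall>n. symmetric_measure M (rho_n M c P n)))"
proof -
  interpret sigma_finite_measure M by fact
  \<comment> \<open>The density is real-valued, hence finite everywhere, which preserves
    sigma-finiteness.\<close>
  have sf: "sigma_finite_measure \<nu>"
    using assms(4,8) by (simp add: sigma_finite_iff_density_finite)
  note hyps = assms(4,5,7,8)
  have nuP: "P \<in> \<nu> \<rightarrow>\<^sub>M prob_algebra \<nu>"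
    using measurable_kernel_nu[OF hyps] assms(7) by blast
  have rev: "reversible M c P \<longleftrightarrow> detailed_balance \<nu> P"
    using reversible_iff_detailed_balance[OF hyps] assms(7) by blast
  have "detailed_balance \<nu> P \<longleftrightarrow> markov_self_adjoint \<nu> P \<and> measure_kernel \<nu> P = \<nu>"
    using detailed_balance_markov_self_adjoint[OF nuP] detailed_balance_measure_kernel[OF nuP]
      markov_self_adjoint_detailed_balance[OF hyps sf] by blast
  moreover have "detailed_balance \<nu> P \<longleftrightarrow> symmetric_operator M (R_op c P)"
    using detailed_balance_symmetric_operator[OF hyps] symmetric_operator_detailed_balance[OF hyps]
    by blast
  ultimately show ?thesis
    using reversible_iterated_kernel_iff[OF hyps] detailed_balance_iff_edge_measure_eq[OF hyps sf]
      detailed_balance_iff_rho[OF hyps] detailed_balance_iff_rho_n[OF hyps]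
    unfolding rev by blast
qed

end
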